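(* Let $\gamma>1$. Let $(\boldsymbol g_t)_{t\ge1}\subset\mathbb R^d$ be any sequence with $\|\boldsymbol g_1\|>0$, and let $(h_t)_{t\ge1}$ be hints such that $(h_t)$ is non-decreasing, $h_t\ge \max_{s\le t}\|\boldsymbol g_s\|$ for all $t\ge 1$, and the hints are multiplied by $c$ whenever the sequence $(\boldsymbol g_s)$ is multiplied by a factor $c>0$. Let $(\widehat{\boldsymbol w}_t)$ be the outputs of Matrix-FreeGrad with parameter $\gamma$ (defined in the context). Let $\boldsymbol V_T:=\sum_{t=1}^T\boldsymbol g_t\boldsymbol g_t^\top$ and $\boldsymbol\Sigma_T^{-1}:=\gamma h_1^2\boldsymbol I+\gamma\boldsymbol V_T$. Then for all $T\ge1$ and all $\boldsymbol w\in\mathbb R^d$, $$\sum_{t=1}^T\langle\widehat{\boldsymbol w}_t-\boldsymbol w,\boldsymbol g_t\rangle\le h_1+\sqrt{Q_T^{\boldsymbol w}\ln_+\left(\frac{\det(\gamma h_1^2\boldsymbol\Sigma_T)^{-1}}{h_1^2}Q_T^{\boldsymbol w}\right)},$$ where $$Q_T^{\boldsymbol w}:=\max\left\{\boldsymbol w^\top\boldsymbol\Sigma_T^{-1}\boldsymbol w,\ \frac12\left(\frac{h_T^2\|\boldsymbol w\|^2}{\rho(\gamma)^2}\ln\left(\frac{\det(\gamma h_1^2\boldsymbol\Sigma_T)^{-1}}{h_1^2}\cdot\frac{h_T^2\|\boldsymbol w\|^2}{\rho(\gamma)^2}\right)+\boldsymbol w^\top\boldsymbol\Sigma_T^{-1}\boldsymbol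 w\right)\right\}.$$
   Context: $\|\cdot\|$ is the Euclidean norm, $\boldsymbol I$ the $d\times d$ identity, $\ln_+(\cdot):=\max\{0,\ln(\cdot)\}$ with $\ln_+0=0$, and $0\ln0=0$ (relevant only for $\boldsymbol w=\boldsymbol0$). For $\gamma\ge1$, $$\rho(\gamma):=\frac1{2\gamma}\left(\sqrt{(\gamma+1)^2-4e^{\frac1{2\gamma}-\frac12}\gamma^{3/2}}+\gamma-1\right).$$ In each round $t\ge1$ the learner sees a hint $h_t$, outputs $\widehat{\boldsymbol w}_t\in\mathbb R^d$, and then $\boldsymbol g_t\in\mathbb R^d$ is revealed. For $\mathbf G\in\mathbb R^d$, positive semidefinite $\boldsymbol V\in\mathbb R^{d\times d}$ and $h>0$ define $$\Psi(\mathbf G,\boldsymbol V,h):=\frac{h_1\exp\left(\inf_{\lambda\ge0}\left\{\frac12\mathbf G^\top(\gamma h_1^2\boldsymbol I+\gamma\boldsymbol V+\lambda\boldsymbol I)^{-1}\mathbf G+\frac{\lambda\rho(\gamma)^2}{2h^2}\right\}\right)}{\sqrt{\det\left(\boldsymbol I+\frac1{h_1^2}\boldsymbol V\right)}}.$$ Matrix-FreeGrad outputs $\widehat{\boldsymbol w}_t:=-\nabla_{\mathbf G}\Psi(\mathbf G,\boldsymbol V_{t-1},h_t)\big|_{\mathbf G=\mathbf G_{t-1}}$ where $\mathbf G_{t-1}:=\sum_{s=1}^{t-1}\boldsymbol g_s$ and $\boldsymbol V_{t-1}:=\sum_{s=1}^{t-1}\boldsymbol g_s\boldsymbol g_s^\top$.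 Equivalently, $\widehat{\boldsymbol w}_t=-\Psi(\mathbf G_{t-1},\boldsymbol V_{t-1},h_t)\,(\gamma h_1^2\boldsymbol I+\gamma\boldsymbol V_{t-1}+\lambda_\star\boldsymbol I)^{-1}\mathbf G_{t-1}$ with $\lambda_\star\geq 0$ attaining the infimum in $\Psi(\mathbf G_{t-1},\boldsymbol V_{t-1},h_t)$. *)

theory Defs
  imports "HOL-Analysis.Analysis"
begin

definition gradient :: "('a::real_inner \<Rightarrow> real) \<Rightarrow> 'a \<Rightarrow> 'a" where
  "gradient f x = (THE D. GDERIV f x :> D)"

text \<open>Only applied to nonnegative arguments. The library's convention \<open>ln 0 = 0\<close> yields
  \<open>ln_plus 0 = 0\<close>, and \<open>0 * ln 0 = 0\<close>.\<close>

definition ln_plus :: "real \<Rightarrow> real" where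
  "ln_plus x = max 0 (ln x)"

definition rho :: "real \<Rightarrow> real" where
  "rho \<gamma> = 1 / (2 * \<gamma>) *
     (sqrt ((\<gamma> + 1)\<^sup>2 - 4 * exp (1 / (2 * \<gamma>) - 1 / 2) * \<gamma> powr (3 / 2)) + \<gamma> - 1)"

text \<open>The rounds are numbered from 1; the value at 0 of a sequence indexed by rounds is never used.\<close>

definition cumG :: "(nat \<Rightarrow> real^'n) \<Rightarrow> nat \<Rightarrow> real^'n" where
  "cumG g T = (\<Sum>t=1..T. g t)"

definition cumV :: "(nat \<Rightarrow> real^'n) \<Rightarrow> nat \<Rightarrow> real^'n^'n" where
  "cumV g T = (\<Sum>t=1..T. \<chi> i j. g t $ i * g t $ j)"

definition Sigma_inv :: "real \<Rightarrow> real \<Rightarrow> real^'n^'n \<Rightarrow> real^'n^'n" where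
  "Sigma_inv \<gamma> h1 V = (\<gamma> * h1\<^sup>2) *\<^sub>R mat 1 + \<gamma> *\<^sub>R V"

definition Psi :: "real \<Rightarrow> real \<Rightarrow> real^'n \<Rightarrow> real^'n^'n \<Rightarrow> real \<Rightarrow> real" where
  "Psi \<gamma> h1 G V h =
     h1 * exp (INF l\<in>{0..}.
            1 / 2 * (G \<bullet> (matrix_inv ((\<gamma> * h1\<^sup>2) *\<^sub>R mat 1 + \<gamma> *\<^sub>R V + l *\<^sub>R mat 1) *v G))
            + l * (rho \<gamma>)\<^sup>2 / (2 * h\<^sup>2))
     / sqrt (det (mat 1 + (1 / h1\<^sup>2) *\<^sub>R V))"

definition matrix_freegrad :: "real \<Rightarrow> (nat \<Rightarrow> real) \<Rightarrow> (nat \<Rightarrow> real^'n) \<Rightarrow> nat \<Rightarrow> real^'n" where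
  "matrix_freegrad \<gamma> h g t =
     - gradient (\<lambda>G. Psi \<gamma> (h 1) G (cumV g (t - 1)) (h t)) (cumG g (t - 1))"

definition Sigma_mat :: "real \<Rightarrow> real \<Rightarrow> real^'n^'n \<Rightarrow> real^'n^'n" where
  "Sigma_mat \<gamma> h1 V = matrix_inv (Sigma_inv \<gamma> h1 V)"

definition det_factor :: "real \<Rightarrow> (nat \<Rightarrow> real) \<Rightarrow> (nat \<Rightarrow> real^'n) \<Rightarrow> nat \<Rightarrow> real" where
  "det_factor \<gamma> h g T =
     inverse (det ((\<gamma> * (h 1)\<^sup>2) *\<^sub>R Sigma_mat \<gamma> (h 1) (cumV g T))) / (h 1)\<^sup>2"

definition Q :: "real \<Rightarrow> (nat \<Rightarrow> real) \<Rightarrow> (nat \<Rightarrow> real^'n) \<Rightarrow> nat \<Rightarrow> real^'n \<Rightarrow> real" where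
  "Q \<gamma> h g T w =
     (let q = w \<bullet> (Sigma_inv \<gamma> (h 1) (cumV g T) *v w);
          x = (h T)\<^sup>2 * (norm w)\<^sup>2 / (rho \<gamma>)\<^sup>2
      in max q (1 / 2 * (x * ln (det_factor \<gamma> h g T * x) + q)))"

end

theory Submission
  imports Defs
begin

text \<open>
  The infimum in the exponent of \<^const>\<open>Psi\<close> is the dual of maximizing the concave quadratic
  \<open>x \<bullet> G - x \<bullet> (\<Sigma>\<inverse> x) / 2\<close> over the ball of radius \<open>\<rho> / h\<close>. Its maximizer is the gradient of the
  exponent in \<open>G\<close>, so \<open>u\<close>, the inner product of this gradient with the new loss \<open>g\<close>, satisfies
  \<open>\<bar>u\<bar> \<le> \<rho>\<close>. Keeping the old multiplier after the update \<open>G + g\<close>, \<open>V + g g\<^sup>T\<close> and computing with the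
  Sherman--Morrison formula and the matrix determinant lemma, the inequality
  \<open>\<Psi>(G + g, V + g g\<^sup>T, h) \<le> \<Psi>(G, V, h) (1 + u)\<close> reduces to a scalar one, in which \<open>\<rho>\<close> is the root of
  \<open>(1 - \<rho>) (1 + \<gamma> \<rho>) = exp (1 / (2 \<gamma>) - 1 / 2) sqrt \<gamma>\<close>. Since \<open>\<Psi>\<close> decreases in \<open>h\<close>, the losses of the
  learner telescope to at most \<open>h\<^sub>1 - \<Psi>(G\<^sub>T, V\<^sub>T, h\<^sub>T)\<close>. It remains to bound the conjugate
  \<open>- w \<bullet> G - \<Psi>(G, V\<^sub>T, h\<^sub>T)\<close> over \<open>G\<close>, for which the dual form is evaluated at a multiple of \<open>- w\<close> in
  the ball.
\<close>

section \<open>Scalar inequalities\<close>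

text \<open>The difference of the two sides vanishes at \<open>0\<close>, and its derivative
  \<open>v * (\<gamma> - 1 + \<gamma> * v) / (1 + v)\<close> is nonnegative for
  \<open>v \<ge> 0\<close> and nonpositive for admissible \<open>v \<le> 0\<close>.\<close>

lemma ln_ge_quadratic:
  fixes \<gamma> u :: real
  assumes "\<gamma> \<ge> 1" "u \<ge> - (\<gamma> - 1) / \<gamma>"
  shows "u - \<gamma> * u\<^sup>2 / 2 \<le> ln (1 + u)"
proof -
  define f where "f = (\<lambda>u. ln (1 + u) - u + \<gamma> * u\<^sup>2 / 2)"
  have pos: "1 + v > 0" if "v \<ge> - (\<gamma> - 1) / \<gamma>" for v
  proof -
    have "- (\<gamma> - 1) / \<gamma> > - 1" using assms by (simp add: field_simps)
    with that show ?thesis by linarith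
  qed
  have der: "(f has_real_derivative v * (\<gamma> - 1 + \<gamma> * v) / (1 + v)) (at v)"
    if "v \<ge> - (\<gamma> - 1) / \<gamma>" for v
    unfolding f_def
    using pos[OF that]
    by (auto intro!: derivative_eq_intros simp: field_simps power2_eq_square)
  have nn: "\<gamma> - 1 + \<gamma> * v \<ge> 0" if "v \<ge> - (\<gamma> - 1) / \<gamma>" for v
    using that assms by (simp add: field_simps)
  have f0: "f 0 = 0" by (simp add: f_def)
  have "f u \<ge> 0"
  proof (cases "u \<ge> 0")
    case True
    have "f 0 \<le> f u"
    proof (rule DERIV_nonneg_imp_nondecreasing[OF True])
      fix v assume v: "0 \<le> v" "v \<le> u"
      have "- (\<gamma> - 1) / \<gamma> \<le> 0" using assms by (simp add: field_simps)
      with v have v': "v \<ge> - (\<gamma> - 1) / \<gamma>" by linarith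
      show "\<exists>y. DERIV f v :> y \<and> 0 \<le> y"
        using der[OF v'] nn[OF v'] pos[OF v'] v by (auto intro!: exI divide_nonneg_pos mult_nonneg_nonneg)
    qed
    then show ?thesis using f0 by simp
  next
    case False
    have "f 0 \<le> f u"
    proof (rule DERIV_nonpos_imp_nonincreasing[of u 0])
      show "u \<le> 0" using False by simp
      fix v assume v: "u \<le> v" "v \<le> 0"
      with assms have v': "v \<ge> - (\<gamma> - 1) / \<gamma>" by linarith
      show "\<exists>y. DERIV f v :> y \<and> y \<le> 0"
        using der[OF v'] nn[OF v'] pos[OF v'] v
        by (auto intro!: exI divide_nonpos_pos mult_nonpos_nonneg)
    qed
    then show ?thesis using f0 by simp
  qed
  then show ?thesis by (simp add: f_def)
qed

text \<open>After taking logarithms the two sides agree at \<open>\<gamma> = 1\<close>, and the difference has derivative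
  \<open>(\<gamma> - 1)\<^sup>2 / (2 \<gamma>\<^sup>2 (\<gamma> + 1))\<close>. Without this bound the square root in \<^const>\<open>rho\<close> would be the junk value
  at a negative argument.\<close>

lemma rho_discriminant_nonneg:
  fixes \<gamma> :: real
  assumes "\<gamma> \<ge> 1"
  shows "4 * exp (1 / (2 * \<gamma>) - 1 / 2) * \<gamma> powr (3 / 2) \<le> (\<gamma> + 1)\<^sup>2"
proof -
  define f where "f = (\<lambda>x::real. 2 * ln (x + 1) - 3 / 2 * ln x - 1 / (2 * x))"
  have "f 1 \<le> f \<gamma>"
  proof (rule DERIV_nonneg_imp_nondecreasing[OF assms])
    fix x :: real assume x: "1 \<le> x" "x \<le> \<gamma>"
    have "(f has_real_derivative 2 / (x + 1) - 3 / (2 * x) + 1 / (2 * x\<^sup>2)) (at x)"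
    proof -
      have d1: "((\<lambda>x. ln (x + 1)) has_real_derivative 1 / (x + 1)) (at x)"
        using x by (auto intro!: derivative_eq_intros)
      have d2: "(ln has_real_derivative 1 / x) (at x)"
        using x by (intro DERIV_ln_divide) simp
      have d3: "((\<lambda>x. 1 / (2 * x)) has_real_derivative - 1 / (2 * x\<^sup>2)) (at x)"
        using x by (auto intro!: derivative_eq_intros simp: power2_eq_square)
      show ?thesis
        unfolding f_def
        by (rule DERIV_cong[OF DERIV_diff[OF DERIV_diff[OF DERIV_cmult[OF d1] DERIV_cmult[OF d2]] d3]])
           simp
    qed
    also have "2 / (x + 1) - 3 / (2 * x) + 1 / (2 * x\<^sup>2) = (x - 1)\<^sup>2 / (2 * x\<^sup>2 * (x + 1))"
      using x by (simp add: divide_simps) (simp add: power2_eq_square algebra_simps)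
    finally have "(f has_real_derivative (x - 1)\<^sup>2 / (2 * x\<^sup>2 * (x + 1))) (at x)" .
    moreover have "(x - 1)\<^sup>2 / (2 * x\<^sup>2 * (x + 1)) \<ge> 0" using x by simp
    ultimately show "\<exists>y. DERIV f x :> y \<and> 0 \<le> y" by blast
  qed
  moreover have "f 1 = 2 * ln 2 - 1 / 2" by (simp add: f_def)
  moreover have "2 * ln (2::real) = ln 4"
    using ln_realpow[of 2 2] by simp
  ultimately have "ln 4 + (1 / (2 * \<gamma>) - 1 / 2) + 3 / 2 * ln \<gamma> \<le> 2 * ln (\<gamma> + 1)"
    by (simp add: f_def)
  then have "exp (ln 4 + (1 / (2 * \<gamma>) - 1 / 2) + 3 / 2 * ln \<gamma>) \<le> exp (2 * ln (\<gamma> + 1))"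
    by simp
  moreover have "exp (2 * ln (\<gamma> + 1)) = (\<gamma> + 1)\<^sup>2"
    using assms by (simp add: exp_double)
  moreover have "exp (ln 4 + (1 / (2 * \<gamma>) - 1 / 2) + 3 / 2 * ln \<gamma>)
      = 4 * exp (1 / (2 * \<gamma>) - 1 / 2) * \<gamma> powr (3 / 2)"
    using assms by (simp only: exp_add powr_def) simp
  ultimately show ?thesis by simp
qed

text \<open>\<open>rho \<gamma>\<close> is the larger root of the quadratic in the third claim, and
  \<open>s\<close> is the square root of its discriminant. Positivity of the constant
  \<open>c\<close> gives \<open>s < \<gamma> + 1\<close>, hence a root below 1.\<close>

lemma
  fixes \<gamma> :: real
  assumes "\<gamma> > 1"
  shows rho_pos: "rho \<gamma> > 0"
    and rho_less_1: "rho \<gamma> < 1"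
    and rho_quadratic: "(1 - rho \<gamma>) * (1 + \<gamma> * rho \<gamma>) = exp (1 / (2 * \<gamma>) - 1 / 2) * sqrt \<gamma>"
proof -
  define c where "c = exp (1 / (2 * \<gamma>) - 1 / 2) * sqrt \<gamma>"
  define s where "s = sqrt ((\<gamma> + 1)\<^sup>2 - 4 * \<gamma> * c)"
  have "\<gamma> powr (3 / 2) = \<gamma> powr (1 + 1 / 2)" by simp
  also have "\<dots> = \<gamma> * sqrt \<gamma>"
    using assms by (subst powr_add) (simp add: powr_half_sqrt)
  finally have p: "\<gamma> powr (3 / 2) = \<gamma> * sqrt \<gamma>" .
  have c0: "c > 0" using assms by (simp add: c_def)
  have r: "rho \<gamma> = (s + \<gamma> - 1) / (2 * \<gamma>)"
    by (simp add: rho_def s_def c_def p mult_ac)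
  have disc: "4 * \<gamma> * c \<le> (\<gamma> + 1)\<^sup>2"
    using rho_discriminant_nonneg[of \<gamma>] assms by (simp add: c_def p mult_ac)
  then have s0: "s \<ge> 0" and s2: "s\<^sup>2 = (\<gamma> + 1)\<^sup>2 - 4 * \<gamma> * c"
    by (simp_all add: s_def)
  show "rho \<gamma> > 0" using s0 assms by (simp add: r)
  have "4 * \<gamma> * c > 0" using c0 assms by simp
  then have "s < \<gamma> + 1"
    using s2 assms by (intro power2_less_imp_less[of s "\<gamma> + 1"]) auto
  then show "rho \<gamma> < 1" using assms by (simp add: r)
  have "s = 2 * \<gamma> * rho \<gamma> - (\<gamma> - 1)" using assms by (simp add: r)
  with s2 have "(2 * \<gamma> * rho \<gamma> - (\<gamma> - 1))\<^sup>2 = (\<gamma> + 1)\<^sup>2 - 4 * \<gamma> * c" by simp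
  then have "4 * \<gamma> * ((1 - rho \<gamma>) * (1 + \<gamma> * rho \<gamma>)) = 4 * \<gamma> * c"
    by (simp add: power2_eq_square algebra_simps)
  then show "(1 - rho \<gamma>) * (1 + \<gamma> * rho \<gamma>) = exp (1 / (2 * \<gamma>) - 1 / 2) * sqrt \<gamma>"
    using assms by (simp add: c_def)
qed

text \<open>For \<open>u \<ge> 0\<close> the factors compare separately. For \<open>u < 0\<close>
  the right-hand side is a concave quadratic in \<open>a = - u\<close>, and \<open>a\<close> lies
  between \<open>a0\<close>, where \<open>1 + \<gamma> * a0 = sqrt \<gamma>\<close>, and
  \<open>rho \<gamma>\<close>, so the endpoints decide.\<close>

lemma rho_bound_far:
  fixes \<gamma> u :: real
  assumes \<gamma>: "\<gamma> > 1" and u: "\<bar>u\<bar> \<le> rho \<gamma>" and far: "\<gamma> \<le> (1 - \<gamma> * u)\<^sup>2"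
  shows "exp (1 / (2 * \<gamma>) - 1 / 2) * sqrt \<gamma> \<le> (1 + u) * \<bar>1 - \<gamma> * u\<bar>"
proof -
  have sq: "sqrt \<gamma> \<le> \<bar>1 - \<gamma> * u\<bar>"
    using real_sqrt_le_mono[OF far] by simp
  have s1: "sqrt \<gamma> > 1" "sqrt \<gamma> * sqrt \<gamma> = \<gamma>" using \<gamma> by simp_all
  show ?thesis
  proof (cases "u \<ge> 0")
    case True
    have "exp (1 / (2 * \<gamma>) - 1 / 2) \<le> exp 0"
      unfolding exp_le_cancel_iff using \<gamma> by (simp add: field_simps)
    then have "exp (1 / (2 * \<gamma>) - 1 / 2) \<le> 1 + u"
      unfolding exp_zero using True by linarith
    then show ?thesis using sq s1 True by (intro mult_mono) auto
  next
    case False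
    define a where "a = - u"
    define a0 where "a0 = (sqrt \<gamma> - 1) / \<gamma>"
    define \<rho> where "\<rho> = rho \<gamma>"
    define P where "P = (\<lambda>a. (1 - a) * (1 + \<gamma> * a))"
    have a: "0 < a" "a \<le> \<rho>" using False u by (auto simp: a_def \<rho>_def)
    have ga: "\<gamma> * a > 0" using a \<gamma> by simp
    have "sqrt \<gamma> \<le> 1 + \<gamma> * a" using sq ga by (simp add: a_def)
    then have a0: "a0 \<le> a" using \<gamma> by (simp add: a0_def field_simps)
    have ga0: "\<gamma> * a0 = sqrt \<gamma> - 1" using \<gamma> by (simp add: a0_def)
    have le: "sqrt \<gamma> \<le> \<gamma>"
      using \<gamma> by (intro real_le_lsqrt) (auto simp: power2_eq_square)
    then have "- a0 \<ge> - (\<gamma> - 1) / \<gamma>" using \<gamma> by (simp add: a0_def field_simps)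
    \<comment> \<open>As \<open>1 + \<gamma> * a0\<close> squares to \<gamma>, the quadratic on the
      left equals the exponent \<open>1 / (2 * \<gamma>) - 1 / 2\<close> of
      \<open>rho_quadratic\<close>.\<close>
    then have "- a0 - \<gamma> * a0\<^sup>2 / 2 \<le> ln (1 - a0)"
      using ln_ge_quadratic[of \<gamma> "- a0"] \<gamma> by simp
    moreover have "- a0 - \<gamma> * a0\<^sup>2 / 2 = (1 - (1 + \<gamma> * a0)\<^sup>2) / (2 * \<gamma>)"
      using \<gamma> by (simp add: field_simps power2_eq_square)
    moreover have "(1 + \<gamma> * a0)\<^sup>2 = \<gamma>" using ga0 \<gamma> by simp
    ultimately have "1 / (2 * \<gamma>) - 1 / 2 \<le> ln (1 - a0)"
      using \<gamma> by (simp add: diff_divide_distrib)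
    moreover have "a0 < 1" using \<gamma> le by (simp add: a0_def)
    ultimately have "exp (1 / (2 * \<gamma>) - 1 / 2) \<le> 1 - a0"
      by (metis diff_gt_0_iff_gt exp_le_cancel_iff exp_ln)
    then have "exp (1 / (2 * \<gamma>) - 1 / 2) * sqrt \<gamma> \<le> (1 - a0) * sqrt \<gamma>"
      using s1(1) by (intro mult_right_mono) auto
    then have ends: "P \<rho> \<le> P a0"
      using rho_quadratic[OF \<gamma>] ga0 by (simp add: P_def \<rho>_def)
    \<comment> \<open>A concave quadratic that is at least \<open>P \<rho>\<close> at \<open>a0\<close> and at \<open>\<rho>\<close> is so in between.\<close>
    have fac: "P a - P \<rho> = (\<rho> - a) * (\<gamma> * (a + \<rho>) - (\<gamma> - 1))" for a
      by (simp add: P_def algebra_simps)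
    have "P \<rho> \<le> P a"
    proof (cases "a0 = \<rho>")
      case True
      then show ?thesis using a a0 by simp
    next
      case False
      then have "\<rho> - a0 > 0" using a a0 by simp
      moreover have "0 \<le> (\<rho> - a0) * (\<gamma> * (a0 + \<rho>) - (\<gamma> - 1))" using ends fac[of a0] by simp
      ultimately have "0 \<le> \<gamma> * (a0 + \<rho>) - (\<gamma> - 1)" by (simp add: zero_le_mult_iff)
      moreover have "\<gamma> * (a0 + \<rho>) \<le> \<gamma> * (a + \<rho>)" using a0 \<gamma> by simp
      ultimately have "0 \<le> (\<rho> - a) * (\<gamma> * (a + \<rho>) - (\<gamma> - 1))" using a by simp
      then show ?thesis using fac[of a] by simp
    qed
    then show ?thesis
      using rho_quadratic[OF \<gamma>] ga by (simp add: P_def \<rho>_def a_def)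
  qed
qed

text \<open>In terms of \<open>y = 1 + \<gamma> z\<close>, the logarithm of the left-hand side is maximal over \<open>y > 0\<close> at
  \<open>y = (1 - \<gamma> u)\<^sup>2 / \<gamma>\<close>. If this point is at least 1, the claim is \<open>rho_bound_far\<close>; otherwise the maximum
  over \<open>y \<ge> 1\<close> is at \<open>y = 1\<close>.\<close>

lemma one_step_scalar:
  fixes \<gamma> u z :: real
  assumes \<gamma>: "\<gamma> > 1" and u: "\<bar>u\<bar> \<le> rho \<gamma>" and z: "z \<ge> 0"
  shows "exp ((2 * u + z - \<gamma> * u\<^sup>2) / (2 * (1 + \<gamma> * z))) / sqrt (1 + \<gamma> * z) \<le> 1 + u"
proof -
  define y where "y = 1 + \<gamma> * z"
  define b where "b = (1 - \<gamma> * u)\<^sup>2"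
  have y: "y \<ge> 1" using \<gamma> z by (simp add: y_def)
  have u1: "1 + u > 0" using u rho_less_1[OF \<gamma>] by linarith
  have zy: "z = (y - 1) / \<gamma>" using \<gamma> by (simp add: y_def)
  have e: "(2 * u + z - \<gamma> * u\<^sup>2) / (2 * y) = 1 / (2 * \<gamma>) - b / (2 * \<gamma> * y)"
    unfolding zy b_def using \<gamma> y by (simp add: divide_simps) (simp add: power2_eq_square algebra_simps)
  have "1 / (2 * \<gamma>) - b / (2 * \<gamma> * y) - ln y / 2 \<le> ln (1 + u)"
  proof (cases "\<gamma> \<le> b")
    case True
    then have b0: "b > 0" using \<gamma> by simp
    \<comment> \<open>This tangent bound is tight at the maximizer \<open>y = b / \<gamma>\<close>,
      so the maximum over \<open>y\<close> needs no calculus.\<close>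
    have "ln (b / (\<gamma> * y)) \<le> b / (\<gamma> * y) - 1"
      using b0 \<gamma> y by (intro ln_le_minus_one) simp
    moreover have "ln (b / (\<gamma> * y)) = ln b - ln \<gamma> - ln y"
      using b0 \<gamma> y by (simp add: ln_div ln_mult)
    moreover have "ln b = 2 * ln \<bar>1 - \<gamma> * u\<bar>"
      using b0 ln_realpow[of "\<bar>1 - \<gamma> * u\<bar>" 2] by (simp add: b_def)
    moreover have "1 / (2 * \<gamma>) - 1 / 2 + ln \<gamma> / 2 \<le> ln (1 + u) + ln \<bar>1 - \<gamma> * u\<bar>"
    proof -
      have nz: "\<bar>1 - \<gamma> * u\<bar> > 0" using b0 by (simp add: b_def)
      have "ln (exp (1 / (2 * \<gamma>) - 1 / 2) * sqrt \<gamma>) \<le> ln ((1 + u) * \<bar>1 - \<gamma> * u\<bar>)"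
        using rho_bound_far[OF \<gamma> u] True u1 nz \<gamma> by (subst ln_le_cancel_iff) (auto simp: b_def)
      then show ?thesis using u1 nz \<gamma> by (simp add: ln_mult ln_sqrt)
    qed
    moreover have "b / (2 * \<gamma> * y) = (b / (\<gamma> * y)) / 2" by simp
    ultimately show ?thesis by linarith
  next
    case False
    \<comment> \<open>This bound and \<open>1 - 1 / y \<le> ln y\<close> are both tight at
      \<open>y = 1\<close>; together they reduce the claim to
      \<open>ln_ge_quadratic\<close>.\<close>
    have "b / \<gamma> * (1 - 1 / y) \<le> 1 * (1 - 1 / y)"
      using False \<gamma> y by (intro mult_right_mono) auto
    moreover have "ln (1 / y) \<le> 1 / y - 1" using y by (intro ln_le_minus_one) simp
    then have "1 - 1 / y \<le> ln y" using y by (simp add: ln_div)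
    ultimately have "b / \<gamma> * (1 - 1 / y) \<le> ln y" by simp
    then have "1 / (2 * \<gamma>) - b / (2 * \<gamma> * y) - ln y / 2 \<le> (1 - b) / (2 * \<gamma>)"
      by (simp add: diff_divide_distrib algebra_simps)
    also have "\<dots> = u - \<gamma> * u\<^sup>2 / 2"
      using \<gamma> by (simp add: b_def field_simps power2_eq_square)
    also have "\<dots> \<le> ln (1 + u)"
    proof (rule ln_ge_quadratic)
      have "\<bar>1 - \<gamma> * u\<bar> < sqrt \<gamma>"
        using False real_sqrt_less_mono[of b \<gamma>] by (simp add: b_def)
      moreover have "sqrt \<gamma> \<le> \<gamma>"
        using \<gamma> by (intro real_le_lsqrt) (auto simp: power2_eq_square)
      ultimately show "- (\<gamma> - 1) / \<gamma> \<le> u" using \<gamma> by (simp add: field_simps)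
    qed (use \<gamma> in simp)
    finally show ?thesis .
  qed
  then have "exp (1 / (2 * \<gamma>) - b / (2 * \<gamma> * y) - ln y / 2) \<le> 1 + u"
    using u1 by (metis exp_le_cancel_iff exp_ln)
  moreover have "exp (ln y / 2) = sqrt y"
    using y exp_ln[of "sqrt y"] by (simp add: ln_sqrt)
  ultimately show ?thesis
    unfolding y_def[symmetric] e by (simp add: exp_diff)
qed

text \<open>The left-hand side is minimal where \<open>y ln (F y) = q\<close>. Such a \<open>y\<close> is used if it satisfies the
  constraint \<open>x \<le> y\<close>, and \<open>y = x\<close> otherwise; the two cases are the two branches of the maximum.\<close>

lemma conjugate_scalar:
  fixes F q x :: real
  assumes F: "F > 0" and q: "q \<ge> 0" and x: "x \<ge> 0"
  defines "M \<equiv> max q (1 / 2 * (x * ln (F * x) + q))"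
  obtains y where "y > 0" "x \<le> y"
    "q / (2 * sqrt y) + sqrt y / 2 * ln (F * y) - sqrt y \<le> sqrt (M * ln_plus (F * M))"
proof (cases "x * ln (F * x) \<le> q")
  case True
  \<comment> \<open>Endpoints for the intermediate value theorem: \<open>y * ln (F * y)\<close> is
    at most \<open>q\<close> at \<open>X\<close>, which is \<open>x\<close> or the zero
    \<open>1 / F\<close>, and at least \<open>q\<close> at \<open>Y\<close>, where the logarithm is
    at least 1 and \<open>Y \<ge> q\<close>.\<close>
  define Y where "Y = max x (max (exp 1 / F) q)"
  define X where "X = max x (1 / F)"
  have X0: "X > 0" using F by (auto simp: X_def less_max_iff_disj)
  have XY: "X \<le> Y"
  proof -
    have "1 / F \<le> exp 1 / F" using F by (intro divide_right_mono) auto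
    then show ?thesis by (auto simp: X_def Y_def)
  qed
  have "X * ln (F * X) \<le> q"
    using True q F by (auto simp: X_def max_def)
  moreover have "q \<le> Y * ln (F * Y)"
  proof -
    have "exp 1 / F \<le> Y" by (simp add: Y_def)
    then have "exp 1 \<le> F * Y" using F by (simp add: field_simps)
    then have "1 \<le> ln (F * Y)" by (meson exp_gt_zero ln_ge_iff less_le_trans)
    then have "Y * 1 \<le> Y * ln (F * Y)" using X0 XY by (intro mult_left_mono) auto
    moreover have "q \<le> Y" by (simp add: Y_def)
    ultimately show ?thesis by simp
  qed
  moreover have "continuous_on {X..Y} (\<lambda>y. y * ln (F * y))"
    using X0 F by (intro continuous_intros) auto
  ultimately obtain y where y: "X \<le> y" "y \<le> Y" "y * ln (F * y) = q"
    using XY IVT'[of "\<lambda>y. y * ln (F * y)" X q Y] by blast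
  have y0: "y > 0" and xy: "x \<le> y" using y X0 by (auto simp: X_def)
  have "1 / F \<le> y" using y by (simp add: X_def)
  then have "1 \<le> F * y" using F by (simp add: field_simps)
  have "q / (2 * sqrt y) = sqrt y / 2 * ln (F * y)"
    using y0 by (simp add: y(3)[symmetric] field_simps)
  then have B: "q / (2 * sqrt y) + sqrt y / 2 * ln (F * y) - sqrt y = sqrt y * (ln (F * y) - 1)"
    by (simp add: algebra_simps)
  have Mq: "q \<le> M" by (simp add: M_def)
  have "sqrt y * (ln (F * y) - 1) \<le> sqrt (M * ln_plus (F * M))"
  proof (cases "ln (F * y) \<le> 1")
    case True
    have "sqrt y * (ln (F * y) - 1) \<le> 0" using True y0 by (simp add: mult_nonneg_nonpos)
    also have "0 \<le> sqrt (M * ln_plus (F * M))" using Mq q by (simp add: ln_plus_def)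
    finally show ?thesis .
  next
    case False
    \<comment> \<open>Since \<open>y * ln (F * y) = q\<close>, a logarithm above 1 forces
      \<open>y \<le> q \<le> M\<close>.\<close>
    then have "y * 1 \<le> y * ln (F * y)" using y0 by (intro mult_left_mono) auto
    then have "y \<le> M" using y(3) Mq by simp
    then have "ln (F * y) \<le> ln (F * M)" using y0 F by simp
    then have l: "ln (F * y) \<le> ln_plus (F * M)" by (simp add: ln_plus_def)
    have "sqrt y * (ln (F * y) - 1) \<le> sqrt y * ln (F * y)" using y0 by simp
    also have "\<dots> = sqrt (q * ln (F * y))"
      using False y0 by (simp add: y(3)[symmetric] real_sqrt_mult)
    also have "\<dots> \<le> sqrt (M * ln_plus (F * M))"
      using l Mq q False by (intro real_sqrt_le_mono mult_mono) auto
    finally show ?thesis .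
  qed
  with B that y0 xy show thesis by simp
next
  case False
  define K where "K = 1 / 2 * (x * ln (F * x) + q)"
  have x0: "x > 0" using False q x by (cases "x = 0") auto
  have MK: "M = K" and Kq: "q \<le> K" using False by (auto simp: M_def K_def)
  have "x = sqrt x * sqrt x" using x0 by simp
  have "q / (2 * sqrt x) + sqrt x / 2 * ln (F * x) = K / sqrt x"
    unfolding K_def using x0 by (simp add: field_simps)
  then have B: "q / (2 * sqrt x) + sqrt x / 2 * ln (F * x) - sqrt x = (K - x) / sqrt x"
    using x0 by (simp add: diff_divide_distrib real_div_sqrt)
  have "(K - x) / sqrt x \<le> sqrt (M * ln_plus (F * M))"
  proof (cases "K \<le> x")
    case True
    then have "(K - x) / sqrt x \<le> 0" using x0 by (simp add: divide_nonpos_pos)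
    also have "0 \<le> sqrt (M * ln_plus (F * M))" using MK Kq q by (simp add: ln_plus_def)
    finally show ?thesis .
  next
    case False': False
    \<comment> \<open>\<open>K\<close> is the mean of \<open>q\<close> and
      \<open>x * ln (F * x)\<close>, the latter being the larger one in this case.\<close>
    have "K \<le> x * ln (F * x)" using False by (simp add: K_def)
    also have "\<dots> \<le> x * ln (F * K)" using False' x0 F by simp
    also have "\<dots> \<le> x * ln_plus (F * K)" using x0 by (simp add: ln_plus_def)
    finally have "K / x \<le> ln_plus (F * K)" using x0 by (simp add: field_simps)
    then have "sqrt (K * (K / x)) \<le> sqrt (K * ln_plus (F * K))"
      using Kq q by (intro real_sqrt_le_mono mult_left_mono) auto
    moreover have "sqrt (K * (K / x)) = K / sqrt x"
      using Kq q by (simp add: real_sqrt_divide)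
    moreover have "(K - x) / sqrt x \<le> K / sqrt x" using x0 by (intro divide_right_mono) auto
    ultimately show ?thesis unfolding MK by linarith
  qed
  with B x0 show thesis by (intro that[of x]) simp_all
qed

text \<open>The shift \<open>L\<close> satisfies \<open>exp L = sqrt F / s\<close>, which places the
  contact point of the tangent bound \<open>1 + t \<le> exp t\<close> at the maximizer of the
  left-hand side in \<open>X\<close>.\<close>

lemma linear_minus_exp_le:
  fixes X s b F :: real
  assumes "s > 0" "F > 0"
  shows "X - exp (s * X - b) / sqrt F \<le> (b - 1 + ln (F / s\<^sup>2) / 2) / s"
proof -
  define L where "L = ln (F / s\<^sup>2) / 2"
  have "exp L = sqrt F / s"
    using assms by (simp add: L_def flip: ln_sqrt) (simp add: real_sqrt_divide)
  then have "s / sqrt F * exp (s * X - b) = exp (s * X - b - L)"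
    using assms by (simp add: exp_diff mult.commute)
  moreover have "1 + (s * X - b - L) \<le> exp (s * X - b - L)" by (rule exp_ge_add_one_self)
  ultimately have "s * (X - exp (s * X - b) / sqrt F) \<le> b - 1 + L"
    by (simp add: algebra_simps)
  then show ?thesis using assms by (simp add: L_def pos_le_divide_eq mult.commute)
qed

section \<open>Rank-one updates and coercive matrices\<close>

definition outer :: "real^'n \<Rightarrow> real^'n \<Rightarrow> real^'n^'n" where
  "outer u v = (\<chi> i j. u $ i * v $ j)"

lemma outer_mult_vec: "outer u v *v x = (v \<bullet> x) *\<^sub>R u"
  by (simp add: outer_def matrix_vector_mult_def vec_eq_iff inner_vec_def sum_distrib_left mult_ac)

lemma outer_scaleR: "c *\<^sub>R outer u v = outer (c *\<^sub>R u) v"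
  by (simp add: outer_def vec_eq_iff)

lemma det_mat_1_plus_outer: "det (mat 1 + outer u v) = 1 + u \<bullet> (v :: real^'n)"
proof -
  \<comment> \<open>Rotating \<open>v\<close> onto a coordinate axis, the matrix differs from the identity in one column only.\<close>
  fix k :: 'n
  obtain f :: "real^'n \<Rightarrow> real^'n"
    where f: "orthogonal_transformation f" "f v = norm v *\<^sub>R axis k 1"
    by (rule orthogonal_transformation_exists[of v "norm v *\<^sub>R axis k 1"]) auto
  define R where "R = matrix f"
  have R: "orthogonal_matrix R" and Rf: "R *v x = f x" for x
    using f(1) by (simp_all add: R_def orthogonal_transformation_matrix orthogonal_transformation_linear)
  have RT: "R ** transpose R = mat 1"
    using R by (simp add: orthogonal_matrix_def)
  have adj: "v \<bullet> (transpose R *v x) = (R *v v) \<bullet> x" for x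
    by (metis dot_lmul_matrix inner_commute transpose_matrix_vector)
  have "R ** (mat 1 + outer u v) ** transpose R = mat 1 + outer (R *v u) (R *v v)"
  proof (subst matrix_eq, intro allI)
    fix x
    have "(R ** (mat 1 + outer u v) ** transpose R) *v x
        = R *v (transpose R *v x) + (v \<bullet> (transpose R *v x)) *\<^sub>R (R *v u)"
      by (simp only: matrix_vector_mul_assoc[symmetric] matrix_vector_mult_add_rdistrib
          matrix_vector_right_distrib outer_mult_vec matrix_vector_mult_scaleR matrix_vector_mul_lid)
    also have "R *v (transpose R *v x) = x"
      by (simp only: matrix_vector_mul_assoc RT matrix_vector_mul_lid)
    finally show "(R ** (mat 1 + outer u v) ** transpose R) *v x
        = (mat 1 + outer (R *v u) (R *v v)) *v x"
      by (simp only: adj matrix_vector_mult_add_rdistrib outer_mult_vec matrix_vector_mul_lid)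
  qed
  then have "det (mat 1 + outer (R *v u) (R *v v)) = det (R ** (mat 1 + outer u v) ** transpose R)"
    by (rule arg_cong[OF sym])
  also have "\<dots> = det (mat 1 + outer u v) * det (R ** transpose R)"
    by (simp add: det_mul)
  also have "det (R ** transpose R) = 1" by (simp add: RT)
  also have "mat 1 + outer (R *v u) (R *v v)
      = (\<chi> i j. if j = k then (mat 1 *v (axis k 1 + norm v *\<^sub>R (R *v u))) $ i else mat 1 $ i $ j)"
    unfolding matrix_vector_mul_lid
    by (auto simp: Rf f(2) outer_def vec_eq_iff mat_def axis_def)
  finally have "det (mat 1 + outer u v) = 1 + norm v * (R *v u) $ k"
    by (simp add: cramer_lemma)
  also have "norm v * (R *v u) $ k = f u \<bullet> f v"
    by (simp add: f(2) Rf inner_axis)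
  also have "\<dots> = u \<bullet> v"
    using f(1) by (simp add: orthogonal_transformation_def)
  finally show ?thesis .
qed

text \<open>Writing the update direction as \<open>A *v a\<close> lets \<open>A\<close> factor out
  on the left without an inverse.\<close>

lemma det_add_outer: "det (A + outer (A *v a) v) = det A * (1 + a \<bullet> (v :: real^'n))"
proof -
  have "A + outer (A *v a) v = A ** (mat 1 + outer a v)"
    unfolding matrix_eq
    by (simp add: matrix_vector_mult_add_rdistrib matrix_vector_right_distrib outer_mult_vec
        matrix_vector_mult_scaleR matrix_vector_mul_assoc[symmetric])
  then show ?thesis by (simp add: det_mul det_mat_1_plus_outer)
qed

text \<open>Positive definiteness with an explicit modulus \<open>m\<close>, so that the inverse is
  bounded by \<open>1 / m\<close>.\<close>

definition sym_coercive :: "real \<Rightarrow> real^'n^'n \<Rightarrow> bool" where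
  "sym_coercive m A \<longleftrightarrow> m > 0 \<and> (\<forall>x y. x \<bullet> (A *v y) = (A *v x) \<bullet> y) \<and> (\<forall>x. m * (x \<bullet> x) \<le> x \<bullet> (A *v x))"

lemma mat_shift_mult_vec: "(A + c *\<^sub>R mat 1) *v x = A *v x + c *\<^sub>R (x :: real^'n)"
  by (simp add: matrix_vector_mult_add_rdistrib flip: scaleR_matrix_vector_assoc)

lemma sym_coercive_shift:
  assumes A: "sym_coercive m A" and l: "l \<ge> 0"
  shows "sym_coercive (m + l) (A + l *\<^sub>R mat 1)"
  unfolding sym_coercive_def
proof (intro conjI allI)
  show "m + l > 0" using A l by (simp add: sym_coercive_def)
  fix x y :: "real^'a"
  have "x \<bullet> (A *v y) = (A *v x) \<bullet> y" "m * (x \<bullet> x) \<le> x \<bullet> (A *v x)"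
    using A by (auto simp only: sym_coercive_def)
  then show "x \<bullet> ((A + l *\<^sub>R mat 1) *v y) = ((A + l *\<^sub>R mat 1) *v x) \<bullet> y"
    "(m + l) * (x \<bullet> x) \<le> x \<bullet> ((A + l *\<^sub>R mat 1) *v x)"
    by (simp_all only: mat_shift_mult_vec inner_add_left inner_add_right distrib_right
        inner_scaleR_left inner_scaleR_right add_le_cancel_right)
qed

lemma sym_coercive_add_outer:
  assumes A: "sym_coercive m A" and c: "c \<ge> 0"
  shows "sym_coercive m (A + c *\<^sub>R outer u u)"
  unfolding sym_coercive_def
proof (intro conjI allI)
  show "m > 0" using A by (simp add: sym_coercive_def)
  have B: "(A + c *\<^sub>R outer u u) *v x = A *v x + (c * (u \<bullet> x)) *\<^sub>R u" for x
    by (simp add: matrix_vector_mult_add_rdistrib outer_mult_vec flip: scaleR_matrix_vector_assoc)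
  fix x y :: "real^'a"
  have "x \<bullet> (A *v y) = (A *v x) \<bullet> y" "m * (x \<bullet> x) \<le> x \<bullet> (A *v x)"
    using A by (auto simp only: sym_coercive_def)
  moreover have "c * (u \<bullet> x) * (x \<bullet> u) \<ge> 0" 
    using c by (metis inner_commute mult.assoc mult_nonneg_nonneg zero_le_square)
  ultimately show "x \<bullet> ((A + c *\<^sub>R outer u u) *v y) = ((A + c *\<^sub>R outer u u) *v x) \<bullet> y"
    "m * (x \<bullet> x) \<le> x \<bullet> ((A + c *\<^sub>R outer u u) *v x)"
    unfolding B inner_add_left inner_add_right inner_scaleR_left inner_scaleR_right
    by (simp_all add: inner_commute)
qed

lemma sym_coercive_nonneg: "sym_coercive m A \<Longrightarrow> 0 \<le> x \<bullet> (A *v x)"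
  by (meson sym_coercive_def inner_ge_zero less_imp_le mult_nonneg_nonneg order_trans)

lemma sym_coercive_invertible:
  assumes "sym_coercive m A" shows "invertible A"
proof -
  have "x = 0" if "A *v x = 0" for x
  proof -
    have "m > 0" "m * (x \<bullet> x) \<le> 0"
      using assms that unfolding sym_coercive_def by (metis inner_zero_right)+
    then have "x \<bullet> x \<le> 0" by (simp add: mult_le_0_iff)
    then show ?thesis by (metis inner_eq_zero_iff inner_ge_zero order_antisym)
  qed
  then show ?thesis
    by (simp add: invertible_left_inverse matrix_left_invertible_ker)
qed

lemma matrix_inv_mult_vec:
  assumes "sym_coercive m A"
  shows "A *v (matrix_inv A *v x) = x" "matrix_inv A *v (A *v x) = x"
proof -
  have "A ** matrix_inv A = mat 1 \<and> matrix_inv A ** A = mat 1"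
    using sym_coercive_invertible[OF assms] unfolding invertible_def matrix_inv_def by (rule someI_ex)
  then show "A *v (matrix_inv A *v x) = x" "matrix_inv A *v (A *v x) = x"
    by (simp_all add: matrix_vector_mul_assoc)
qed

lemma matrix_inv_mult_vec_eqI:
  assumes "sym_coercive m A" "A *v x = y"
  shows "matrix_inv A *v y = x"
  using assms matrix_inv_mult_vec(2) by blast

lemma sym_coercive_inv_sym:
  assumes "sym_coercive m A"
  shows "x \<bullet> (matrix_inv A *v y) = (matrix_inv A *v x) \<bullet> y"
  by (metis assms matrix_inv_mult_vec(1) sym_coercive_def)

lemma sym_coercive_inv_nonneg:
  assumes "sym_coercive m A"
  shows "0 \<le> x \<bullet> (matrix_inv A *v x)"
  by (metis assms inner_commute matrix_inv_mult_vec(1) sym_coercive_nonneg)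

text \<open>Coercivity is tested at the preimage \<open>y\<close> of \<open>x\<close>;
  Cauchy--Schwarz then allows cancelling one factor \<open>norm y\<close>.\<close>

lemma norm_matrix_inv_le:
  assumes A: "sym_coercive m A"
  shows "norm (matrix_inv A *v x) \<le> norm x / m"
proof -
  define y where "y = matrix_inv A *v x"
  have m: "m > 0" using A by (simp add: sym_coercive_def)
  have "m * (norm y * norm y) \<le> y \<bullet> x"
    using A by (metis matrix_inv_mult_vec(1) power2_eq_square power2_norm_eq_inner sym_coercive_def y_def)
  also have "\<dots> \<le> norm y * norm x" by (rule norm_cauchy_schwarz)
  finally have "norm y * (m * norm y) \<le> norm y * norm x" by (simp add: mult_ac)
  then have "m * norm y \<le> norm x"
    by (cases "y = 0") auto
  then show ?thesis using m by (simp add: y_def pos_le_divide_eq mult.commute)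
qed

text \<open>Expands the nonnegative quadratic form of \<open>A\<close> at the distance of
  \<open>x\<close> from the maximizer \<open>matrix_inv A *v G\<close>.\<close>

lemma fenchel_young_quadratic:
  assumes A: "sym_coercive m A"
  shows "x \<bullet> G - 1 / 2 * (x \<bullet> (A *v x)) \<le> 1 / 2 * (G \<bullet> (matrix_inv A *v G))"
proof -
  define z where "z = matrix_inv A *v G"
  have G: "G = A *v z" by (simp add: z_def matrix_inv_mult_vec[OF A])
  have "0 \<le> (x - z) \<bullet> (A *v (x - z))" by (rule sym_coercive_nonneg[OF A])
  also have "\<dots> = x \<bullet> (A *v x) - 2 * (x \<bullet> G) + G \<bullet> z"
  proof -
    have "z \<bullet> (A *v x) = x \<bullet> G" using A by (metis G inner_commute sym_coercive_def)
    then show ?thesis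
      by (simp add: matrix_vector_mult_diff_distrib inner_diff_left inner_diff_right inner_commute flip: G)
  qed
  finally show ?thesis by (simp add: z_def)
qed

lemma sherman_morrison:
  fixes g :: "real^'n"
  assumes A: "sym_coercive m A" and c: "c \<ge> 0"
  defines "p \<equiv> matrix_inv A *v g"
  shows "matrix_inv (A + c *\<^sub>R outer g g) *v x
    = matrix_inv A *v x - (c * (p \<bullet> x) / (1 + c * (g \<bullet> p))) *\<^sub>R p"
proof (rule matrix_inv_mult_vec_eqI[OF sym_coercive_add_outer[OF A c]])
  define k where "k = c * (p \<bullet> x) / (1 + c * (g \<bullet> p))"
  have "1 + c * (g \<bullet> p) > 0"
    using c sym_coercive_inv_nonneg[OF A, of g] by (simp add: p_def add_pos_nonneg)
  then have "k * (1 + c * (g \<bullet> p)) = c * (p \<bullet> x)" by (simp add: k_def)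
  \<comment> \<open>This fixed-point form of \<open>k\<close> makes the two multiples of
    \<open>g\<close> cancel below.\<close>
  then have k: "k = c * (p \<bullet> x - k * (g \<bullet> p))" by (simp add: algebra_simps)
  have "g \<bullet> (matrix_inv A *v x) = p \<bullet> x" by (simp add: p_def sym_coercive_inv_sym[OF A])
  moreover have "A *v p = g" "A *v (matrix_inv A *v x) = x"
    by (simp_all add: p_def matrix_inv_mult_vec[OF A])
  ultimately have "(A + c *\<^sub>R outer g g) *v (matrix_inv A *v x - k *\<^sub>R p)
      = x - k *\<^sub>R g + (c * (p \<bullet> x - k * (g \<bullet> p))) *\<^sub>R g"
    by (simp add: matrix_vector_mult_add_rdistrib matrix_vector_mult_diff_distrib outer_mult_vec
        matrix_vector_mult_scaleR inner_diff_right scaleR_diff_left scaleR_add_right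
        scaleR_add_left right_diff_distrib mult_ac flip: scaleR_matrix_vector_assoc)
  also have "\<dots> = x" by (simp flip: k)
  finally show "(A + c *\<^sub>R outer g g) *v (matrix_inv A *v x -
    (c * (p \<bullet> x) / (1 + c * (g \<bullet> p))) *\<^sub>R p) = x" by (simp add: k_def)
qed

section \<open>The resolvent and the choice of the multiplier\<close>

text \<open>The resolvent identity \<open>res\<close> and the uniform bound \<open>1 / m\<close>
  make the map Lipschitz.\<close>

lemma continuous_on_resolvent:
  assumes A: "sym_coercive m A"
  shows "continuous_on {0..} (\<lambda>l. matrix_inv (A + l *\<^sub>R mat 1) *v G)"
proof -
  define R where "R = (\<lambda>l. matrix_inv (A + l *\<^sub>R mat 1))"
  have m: "m > 0" using A by (simp add: sym_coercive_def)
  have bd: "norm (R l *v x) \<le> norm x / m" if "l \<ge> 0" for l x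
  proof -
    have "norm (R l *v x) \<le> norm x / (m + l)"
      unfolding R_def by (rule norm_matrix_inv_le[OF sym_coercive_shift[OF A that]])
    also have "\<dots> \<le> norm x / m" using m that by (intro divide_left_mono) auto
    finally show ?thesis .
  qed
  have res: "R a *v G - R b *v G = (b - a) *\<^sub>R (R a *v (R b *v G))" if "a \<ge> 0" "b \<ge> 0" for a b
  proof -
    define y where "y = R b *v G"
    have "(A + b *\<^sub>R mat 1) *v y = G"
      unfolding y_def R_def by (rule matrix_inv_mult_vec[OF sym_coercive_shift[OF A that(2)]])
    then have "G = (A + a *\<^sub>R mat 1) *v y + (b - a) *\<^sub>R y"
      by (simp add: mat_shift_mult_vec scaleR_left_diff_distrib)
    then have "R a *v G = y + (b - a) *\<^sub>R (R a *v y)"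
      using matrix_inv_mult_vec(2)[OF sym_coercive_shift[OF A that(1)], of y]
      by (metis R_def matrix_vector_mult_scaleR matrix_vector_right_distrib)
    then show ?thesis by (simp add: y_def)
  qed
  have "(norm G / m / m)-lipschitz_on {0..} (\<lambda>l. R l *v G)"
  proof (rule lipschitz_onI)
    fix a b :: real assume ab: "a \<in> {0..}" "b \<in> {0..}"
    have "norm (R a *v (R b *v G)) \<le> norm (R b *v G) / m" using bd ab by simp
    also have "\<dots> \<le> norm G / m / m" using bd ab m by (intro divide_right_mono) auto
    finally have "\<bar>b - a\<bar> * norm (R a *v (R b *v G)) \<le> \<bar>b - a\<bar> * (norm G / m / m)"
      by (rule mult_left_mono) simp
    then show "dist (R a *v G) (R b *v G) \<le> norm G / m / m * dist a b"
      using ab by (simp add: dist_norm res mult_ac abs_minus_commute)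
  qed (use m in simp)
  then show ?thesis unfolding R_def by (rule lipschitz_on_continuous_on)
qed

text \<open>Either the unconstrained maximizer lies in the ball, or the intermediate value theorem
  gives a multiplier that puts it on the sphere; at \<open>L = norm G / r\<close> it is inside. The
  last alternative is complementary slackness.\<close>

lemma ex_multiplier:
  assumes A: "sym_coercive m A" and r: "r > 0"
  obtains l where "l \<ge> 0" "norm (matrix_inv (A + l *\<^sub>R mat 1) *v G) \<le> r"
    "l = 0 \<or> norm (matrix_inv (A + l *\<^sub>R mat 1) *v G) = r"
proof -
  define N where "N = (\<lambda>l. norm (matrix_inv (A + l *\<^sub>R mat 1) *v G))"
  show thesis
  proof (cases "N 0 \<le> r")
    case True
    then show ?thesis using that[of 0] by (simp add: N_def)
  next
    case False
    have m: "m > 0" using A by (simp add: sym_coercive_def)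
    define L where "L = norm G / r"
    have L: "L \<ge> 0" using r by (simp add: L_def)
    have "N L \<le> norm G / (m + L)"
      unfolding N_def by (rule norm_matrix_inv_le[OF sym_coercive_shift[OF A L]])
    also have "\<dots> \<le> r"
    proof -
      have "norm G \<le> r * (m + L)" using r m by (simp add: L_def distrib_left)
      then show ?thesis using L m by (simp add: pos_divide_le_eq)
    qed
    finally have "N L \<le> r" .
    moreover have "continuous_on {0..L} N"
      unfolding N_def
      by (intro continuous_on_norm continuous_on_subset[OF continuous_on_resolvent[OF A]]) auto
    ultimately obtain l where "0 \<le> l" "l \<le> L" "N l = r"
      using IVT2'[of N L r 0] L False by auto
    then show ?thesis using that[of l] by (simp add: N_def)
  qed
qed

section \<open>The conjugate of a quadratic on a ball\<close>

text \<open>By Lagrangian duality this is the supremum of \<open>x \<bullet> G - x \<bullet> (S *v x) / 2\<close> over the ball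
  \<open>norm x \<le> r\<close>, with \<open>l\<close> the multiplier of the constraint.\<close>

definition ball_conj :: "real \<Rightarrow> real^'n^'n \<Rightarrow> real^'n \<Rightarrow> real" where
  "ball_conj r S G = (INF l\<in>{0..}. 1 / 2 * (G \<bullet> (matrix_inv (S + l *\<^sub>R mat 1) *v G)) + l * r\<^sup>2 / 2)"

lemma ball_conj_le:
  assumes S: "sym_coercive m S" and l: "l \<ge> 0"
  shows "ball_conj r S G \<le> 1 / 2 * (G \<bullet> (matrix_inv (S + l *\<^sub>R mat 1) *v G)) + l * r\<^sup>2 / 2"
  unfolding ball_conj_def
proof (rule cINF_lower)
  show "bdd_below ((\<lambda>l. 1 / 2 * (G \<bullet> (matrix_inv (S + l *\<^sub>R mat 1) *v G)) + l * r\<^sup>2 / 2) ` {0..})"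
    using sym_coercive_inv_nonneg[OF sym_coercive_shift[OF S]]
    by (intro bdd_belowI2[where m = 0]) (simp add: add_nonneg_nonneg)
qed (use l in simp)

text \<open>Weak duality: for each multiplier, Fenchel--Young for the shifted matrix is combined
  with \<open>l * (x \<bullet> x) \<le> l * r\<^sup>2\<close>.\<close>

lemma ball_conj_ge:
  assumes S: "sym_coercive m S" and x: "norm x \<le> r"
  shows "x \<bullet> G - 1 / 2 * (x \<bullet> (S *v x)) \<le> ball_conj r S G"
  unfolding ball_conj_def
proof (rule cINF_greatest)
  fix l :: real assume "l \<in> {0..}"
  then have l: "l \<ge> 0" by simp
  have "(norm x)\<^sup>2 \<le> r\<^sup>2" using x by (intro power_mono) auto
  then have "l * (x \<bullet> x) \<le> l * r\<^sup>2"
    using l by (intro mult_left_mono) (simp_all add: power2_norm_eq_inner)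
  moreover have "x \<bullet> G - 1 / 2 * (x \<bullet> (S *v x) + l * (x \<bullet> x))
      \<le> 1 / 2 * (G \<bullet> (matrix_inv (S + l *\<^sub>R mat 1) *v G))"
    using fenchel_young_quadratic[OF sym_coercive_shift[OF S l], of x G]
    by (simp add: mat_shift_mult_vec inner_add_right)
  ultimately show "x \<bullet> G - 1 / 2 * (x \<bullet> (S *v x))
      \<le> 1 / 2 * (G \<bullet> (matrix_inv (S + l *\<^sub>R mat 1) *v G)) + l * r\<^sup>2 / 2"
    by (simp add: algebra_simps)
qed simp

text \<open>Complementary slackness turns \<open>l * (x \<bullet> x)\<close> into
  \<open>l * r\<^sup>2\<close>, so the primal value at \<open>x\<close> meets the dual value at
  \<open>l\<close>, with the infimum squeezed between them.\<close>

lemma ball_conj_attained: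
  fixes G :: "real^'n"
  assumes S: "sym_coercive m S" and l: "l \<ge> 0"
  defines "x \<equiv> matrix_inv (S + l *\<^sub>R mat 1) *v G"
  assumes x: "norm x \<le> r" "l = 0 \<or> norm x = r"
  shows "ball_conj r S G = 1 / 2 * (G \<bullet> x) + l * r\<^sup>2 / 2"
    and "ball_conj r S G = x \<bullet> G - 1 / 2 * (x \<bullet> (S *v x))"
proof -
  have "(S + l *\<^sub>R mat 1) *v x = G"
    unfolding x_def by (rule matrix_inv_mult_vec[OF sym_coercive_shift[OF S l]])
  then have "x \<bullet> G = x \<bullet> (S *v x) + l * (x \<bullet> x)"
    by (auto simp: mat_shift_mult_vec inner_add_right)
  moreover have "l * (x \<bullet> x) = l * r\<^sup>2"
    using x(2) by (auto simp: power2_norm_eq_inner)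
  ultimately have eq: "x \<bullet> G - 1 / 2 * (x \<bullet> (S *v x)) = 1 / 2 * (G \<bullet> x) + l * r\<^sup>2 / 2"
    by (simp add: inner_commute add_divide_distrib)
  show 1: "ball_conj r S G = 1 / 2 * (G \<bullet> x) + l * r\<^sup>2 / 2"
    using ball_conj_le[OF S l, of r G] ball_conj_ge[OF S x(1), of G] eq by (simp add: x_def)
  then show "ball_conj r S G = x \<bullet> G - 1 / 2 * (x \<bullet> (S *v x))" using eq by simp
qed

text \<open>The maximizer for the smaller ball is feasible for the larger one.\<close>

lemma ball_conj_mono:
  assumes S: "sym_coercive m S" and r: "0 < r" "r \<le> r'"
  shows "ball_conj r S G \<le> ball_conj r' S G"
proof -
  obtain l where l: "l \<ge> 0" "norm (matrix_inv (S + l *\<^sub>R mat 1) *v G) \<le> r"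
    "l = 0 \<or> norm (matrix_inv (S + l *\<^sub>R mat 1) *v G) = r"
    using ex_multiplier[OF S r(1)] by blast
  show ?thesis
    unfolding ball_conj_attained(2)[OF S l] using l r by (intro ball_conj_ge[OF S]) simp
qed

text \<open>The maximizer \<open>x\<close> bounds the function from below by an affine function, and the fixed
  multiplier \<open>l\<close> bounds it from above by a quadratic; the two touch at \<open>G\<close> with common gradient \<open>x\<close>.\<close>

lemma ball_conj_GDERIV:
  fixes G :: "real^'n"
  assumes S: "sym_coercive m S" and l: "l \<ge> 0"
  defines "x \<equiv> matrix_inv (S + l *\<^sub>R mat 1) *v G"
  assumes x: "norm x \<le> r" "l = 0 \<or> norm x = r"
  shows "GDERIV (ball_conj r S) G :> x"
proof -
  define R where "R = matrix_inv (S + l *\<^sub>R mat 1)"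
  define k where "k = m + l"
  have Sl: "sym_coercive k (S + l *\<^sub>R mat 1)" unfolding k_def by (rule sym_coercive_shift[OF S l])
  define c where "c = 1 / (2 * k)"
  note att = ball_conj_attained[OF S l x[unfolded x_def], folded x_def]
  have lower: "ball_conj r S G + (y - G) \<bullet> x \<le> ball_conj r S y" for y
    using ball_conj_ge[OF S x(1), of y] att(2) inner_diff_right[of x y G] by (simp add: inner_commute)
  have upper: "ball_conj r S y \<le> ball_conj r S G + (y - G) \<bullet> x + c * (norm (y - G))\<^sup>2" for y
  proof -
    define d where "d = y - G"
    have y: "y = G + d" by (simp add: d_def)
    have "d \<bullet> (R *v d) \<le> norm d * (norm d / k)"
      unfolding R_def
      by (rule order_trans[OF norm_cauchy_schwarz mult_left_mono[OF norm_matrix_inv_le[OF Sl]]]) simp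
    then have cd: "1 / 2 * (d \<bullet> (R *v d)) \<le> c * (norm d)\<^sup>2"
      by (simp add: c_def power2_eq_square)
    have "y \<bullet> (R *v y) = G \<bullet> x + 2 * (d \<bullet> x) + d \<bullet> (R *v d)"
      using sym_coercive_inv_sym[OF Sl, of G d, folded R_def]
      by (simp add: y x_def R_def[symmetric] matrix_vector_right_distrib inner_add_left
          inner_add_right inner_commute)
    then show ?thesis
      using ball_conj_le[OF S l, of r y, folded R_def] att(1) cd
      unfolding d_def[symmetric] by linarith
  qed
  have "k > 0" using Sl by (simp add: sym_coercive_def)
  then have c: "c \<ge> 0" by (simp add: c_def)
  show ?thesis
    unfolding gderiv_def
  proof (rule has_derivativeI_sandwich[where e = 1 and H = "\<lambda>y. c * norm (y - G)"])
    show "bounded_linear (\<lambda>h. h \<bullet> x)" by (rule bounded_linear_inner_left)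
    show "((\<lambda>y. c * norm (y - G)) \<longlongrightarrow> 0) (at G)"
      by (auto intro!: tendsto_eq_intros)
    fix y assume "y \<noteq> G"
    have "\<bar>ball_conj r S y - ball_conj r S G - (y - G) \<bullet> x\<bar> \<le> c * norm (y - G) * norm (y - G)"
      using lower[of y] upper[of y] by (simp add: abs_le_iff power2_eq_square mult.assoc)
    then show "norm (ball_conj r S y - ball_conj r S G - (y - G) \<bullet> x) / norm (y - G) \<le> c * norm (y - G)"
      using \<open>y \<noteq> G\<close> by (simp add: pos_divide_le_eq)
  qed simp
qed

text \<open>Any multiplier bounds the infimum from above, so the old one can be kept;
  Sherman--Morrison then evaluates the new quadratic form.\<close>

lemma ball_conj_step:
  fixes G g :: "real^'n"
  assumes S: "sym_coercive m S" and l: "l \<ge> 0" and \<gamma>: "\<gamma> \<ge> 0"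
  defines "R \<equiv> matrix_inv (S + l *\<^sub>R mat 1)"
  assumes x: "norm (R *v G) \<le> r" "l = 0 \<or> norm (R *v G) = r"
  defines "u \<equiv> (R *v G) \<bullet> g" and "z \<equiv> g \<bullet> (R *v g)"
  shows "ball_conj r (S + \<gamma> *\<^sub>R outer g g) (G + g)
    \<le> ball_conj r S G + (2 * u + z - \<gamma> * u\<^sup>2) / (2 * (1 + \<gamma> * z))"
proof -
  have Sl: "sym_coercive (m + l) (S + l *\<^sub>R mat 1)" by (rule sym_coercive_shift[OF S l])
  have z: "1 + \<gamma> * z > 0"
    using \<gamma> sym_coercive_inv_nonneg[OF Sl, of g] by (simp add: z_def R_def add_pos_nonneg)
  have sym: "G \<bullet> (R *v g) = u" "(R *v g) \<bullet> G = u" "g \<bullet> (R *v G) = u"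
    using sym_coercive_inv_sym[OF Sl, of G g, folded R_def] by (auto simp: u_def inner_commute)
  have p: "(R *v g) \<bullet> (G + g) = u + z" "(G + g) \<bullet> (R *v g) = u + z"
    using sym by (simp_all add: z_def inner_add_left inner_add_right inner_commute)
  have comm: "S + \<gamma> *\<^sub>R outer g g + l *\<^sub>R mat 1 = (S + l *\<^sub>R mat 1) + \<gamma> *\<^sub>R outer g g"
    by simp
  have "(G + g) \<bullet> (matrix_inv (S + \<gamma> *\<^sub>R outer g g + l *\<^sub>R mat 1) *v (G + g))
      = (G + g) \<bullet> (R *v (G + g)) - \<gamma> * (u + z) / (1 + \<gamma> * z) * (u + z)"
    unfolding comm sherman_morrison[OF Sl \<gamma>] R_def[symmetric] z_def[symmetric] p(1)
    by (simp add: inner_diff_right p(2))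
  also have "(G + g) \<bullet> (R *v (G + g)) = G \<bullet> (R *v G) + 2 * u + z"
    using sym by (simp add: matrix_vector_right_distrib inner_add_left inner_add_right z_def)
  finally have "1 / 2 * ((G + g) \<bullet> (matrix_inv (S + \<gamma> *\<^sub>R outer g g + l *\<^sub>R mat 1) *v (G + g)))
      = 1 / 2 * (G \<bullet> (R *v G)) + 1 / 2 * (2 * u + z - \<gamma> * (u + z) / (1 + \<gamma> * z) * (u + z))"
    by simp
  also have "2 * u + z - \<gamma> * (u + z) / (1 + \<gamma> * z) * (u + z) = (2 * u + z - \<gamma> * u\<^sup>2) / (1 + \<gamma> * z)"
  proof -
    have "(2 * u + z) * (1 + \<gamma> * z) - \<gamma> * (u + z) * (u + z) = 2 * u + z - \<gamma> * u\<^sup>2"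
      by (simp add: power2_eq_square algebra_simps)
    then show ?thesis using z by (simp add: diff_divide_eq_iff)
  qed
  also have "1 / 2 * ((2 * u + z - \<gamma> * u\<^sup>2) / (1 + \<gamma> * z)) = (2 * u + z - \<gamma> * u\<^sup>2) / (2 * (1 + \<gamma> * z))"
    by (rule times_divide_times_eq[of 1 2, unfolded mult_1])
  finally show ?thesis
    using ball_conj_le[OF sym_coercive_add_outer[OF S \<gamma>, of g] l, of r "G + g"]
      ball_conj_attained(1)[OF S l x[unfolded R_def], folded R_def]
    by linarith
qed

section \<open>The potential\<close>

lemma gradient_eqI:
  assumes "GDERIV f x :> D" shows "gradient f x = D"
  unfolding gradient_def
proof (rule the_equality[where P = "\<lambda>D. GDERIV f x :> D", OF assms])
  fix D' assume "GDERIV f x :> D'"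
  then have "(\<lambda>h. h \<bullet> D') = (\<lambda>h. h \<bullet> D)"
    using assms unfolding gderiv_def by (rule has_derivative_unique)
  then show "D' = D" by (metis vector_eq_ldot)
qed

lemma Psi_eq:
  "Psi \<gamma> h1 G V h
    = h1 * exp (ball_conj (rho \<gamma> / h) (Sigma_inv \<gamma> h1 V) G) / sqrt (det (mat 1 + (1 / h1\<^sup>2) *\<^sub>R V))"
  by (simp add: Psi_def ball_conj_def Sigma_inv_def power_divide mult.commute)

lemma Sigma_inv_add_outer: "Sigma_inv \<gamma> h1 (V + outer g g) = Sigma_inv \<gamma> h1 V + \<gamma> *\<^sub>R outer g g"
  by (simp add: Sigma_inv_def scaleR_right_distrib)

text \<open>\<open>Sigma_inv\<close> is \<open>\<gamma> * h1\<^sup>2\<close> times the matrix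
  \<open>M\<close> under the determinant, so solving with \<open>Sigma_inv\<close> also solves with
  \<open>M\<close> and \<open>det_add_outer\<close> applies.\<close>

lemma det_add_outer_Sigma_inv:
  assumes S: "sym_coercive m (Sigma_inv \<gamma> h1 V)" and pos: "h1 > 0" "\<gamma> > 0"
  shows "det (mat 1 + (1 / h1\<^sup>2) *\<^sub>R (V + outer g g))
    = det (mat 1 + (1 / h1\<^sup>2) *\<^sub>R V) * (1 + \<gamma> * (g \<bullet> (matrix_inv (Sigma_inv \<gamma> h1 V) *v g)))"
proof -
  define M where "M = mat 1 + (1 / h1\<^sup>2) *\<^sub>R V"
  define a where "a = matrix_inv (Sigma_inv \<gamma> h1 V) *v g"
  have SM: "Sigma_inv \<gamma> h1 V = (\<gamma> * h1\<^sup>2) *\<^sub>R M"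
    using pos by (simp add: Sigma_inv_def M_def scaleR_right_distrib)
  have "(\<gamma> * h1\<^sup>2) *\<^sub>R (M *v a) = g"
    using matrix_inv_mult_vec(1)[OF S, of g]
    by (simp add: a_def SM scaleR_matrix_vector_assoc)
  then have "M *v (\<gamma> *\<^sub>R a) = (1 / h1\<^sup>2) *\<^sub>R g"
    using pos by (auto simp: matrix_vector_mult_scaleR)
  then have "mat 1 + (1 / h1\<^sup>2) *\<^sub>R (V + outer g g) = M + outer (M *v (\<gamma> *\<^sub>R a)) g"
    by (simp add: M_def scaleR_right_distrib outer_scaleR)
  then show ?thesis
    by (simp add: det_add_outer M_def[symmetric] a_def inner_commute)
qed

lemma Psi_step:
  assumes \<gamma>: "\<gamma> > 1" and h1: "h1 > 0" and h: "h > 0" and S: "sym_coercive m (Sigma_inv \<gamma> h1 V)"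
    and D: "det (mat 1 + (1 / h1\<^sup>2) *\<^sub>R V) > 0" and g: "norm g \<le> h"
  shows "Psi \<gamma> h1 (G + g) (V + outer g g) h
    \<le> Psi \<gamma> h1 G V h + gradient (\<lambda>G. Psi \<gamma> h1 G V h) G \<bullet> g"
proof -
  define S where "S = Sigma_inv \<gamma> h1 V"
  define D where "D = det (mat 1 + (1 / h1\<^sup>2) *\<^sub>R V)"
  define r where "r = rho \<gamma> / h"
  note S = S[folded S_def] and D = D[folded D_def]
  have r: "r > 0" using rho_pos[OF \<gamma>] h by (simp add: r_def)
  obtain l where l: "l \<ge> 0" "norm (matrix_inv (S + l *\<^sub>R mat 1) *v G) \<le> r"
    "l = 0 \<or> norm (matrix_inv (S + l *\<^sub>R mat 1) *v G) = r"
    using ex_multiplier[OF S r] by blast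
  define R where "R = matrix_inv (S + l *\<^sub>R mat 1)"
  define x where "x = R *v G"
  define u where "u = x \<bullet> g"
  define z where "z = g \<bullet> (R *v g)"
  define z0 where "z0 = g \<bullet> (matrix_inv S *v g)"
  have Sl: "sym_coercive (m + l) (S + l *\<^sub>R mat 1)" by (rule sym_coercive_shift[OF S l(1)])
  have z: "z \<ge> 0" unfolding z_def R_def by (rule sym_coercive_inv_nonneg[OF Sl])
  \<comment> \<open>The exponent involves \<open>z\<close>, from the shifted matrix, but the
    determinant grows by \<open>1 + \<gamma> * z0\<close>, from the unshifted one. This comparison
    lets the denominator use \<open>z\<close> as well, as \<open>one_step_scalar\<close>
    requires.\<close>
  have zz0: "z \<le> z0"
  proof -
    define y where "y = R *v g"
    have "S *v y + l *\<^sub>R y = g"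
      using matrix_inv_mult_vec(1)[OF Sl, of g] by (simp add: y_def R_def mat_shift_mult_vec)
    then have "y \<bullet> (S *v y) + l * (y \<bullet> y) = y \<bullet> g"
      by (metis inner_add_right inner_scaleR_right)
    moreover have "l * (y \<bullet> y) \<ge> 0" using l by simp
    ultimately have "y \<bullet> (S *v y) \<le> y \<bullet> g" by linarith
    then show ?thesis
      using fenchel_young_quadratic[OF S, of y g]
      by (simp add: z_def z0_def inner_commute flip: y_def)
  qed
  have u: "\<bar>u\<bar> \<le> rho \<gamma>"
  proof -
    have "\<bar>u\<bar> \<le> norm x * norm g" unfolding u_def by (rule Cauchy_Schwarz_ineq2)
    also have "\<dots> \<le> r * h" using l g r by (intro mult_mono) (auto simp: x_def R_def)
    also have "\<dots> = rho \<gamma>" using h by (simp add: r_def)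
    finally show ?thesis .
  qed
  have P: "Psi \<gamma> h1 G V h = h1 / sqrt D * exp (ball_conj r S G)" for G
    by (simp add: Psi_eq S_def D_def r_def)
  have "GDERIV (ball_conj r S) G :> x"
    unfolding x_def R_def by (rule ball_conj_GDERIV[OF S l])
  then have "GDERIV (\<lambda>G. Psi \<gamma> h1 G V h) G :> Psi \<gamma> h1 G V h *\<^sub>R x"
    unfolding P by (rule GDERIV_DERIV_compose[OF _ DERIV_cmult[OF DERIV_exp]])
  then have grad: "gradient (\<lambda>G. Psi \<gamma> h1 G V h) G \<bullet> g = Psi \<gamma> h1 G V h * u"
    by (simp add: gradient_eqI u_def)
  have "Psi \<gamma> h1 (G + g) (V + outer g g) h
      = h1 * exp (ball_conj r (S + \<gamma> *\<^sub>R outer g g) (G + g)) / sqrt (D * (1 + \<gamma> * z0))"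
    using det_add_outer_Sigma_inv[OF S[unfolded S_def] h1, of g] \<gamma>
    by (simp add: Psi_eq Sigma_inv_add_outer S_def D_def r_def z0_def)
  also have "\<dots> \<le> h1 * exp (ball_conj r S G + (2 * u + z - \<gamma> * u\<^sup>2) / (2 * (1 + \<gamma> * z)))
      / sqrt (D * (1 + \<gamma> * z))"
  proof (rule frac_le)
    show "sqrt (D * (1 + \<gamma> * z)) \<le> sqrt (D * (1 + \<gamma> * z0))"
      using zz0 D \<gamma> by simp
    show "0 < sqrt (D * (1 + \<gamma> * z))" using D z \<gamma> by (simp add: add_pos_nonneg)
    show "h1 * exp (ball_conj r (S + \<gamma> *\<^sub>R outer g g) (G + g))
        \<le> h1 * exp (ball_conj r S G + (2 * u + z - \<gamma> * u\<^sup>2) / (2 * (1 + \<gamma> * z)))"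
      using ball_conj_step[OF S l(1) _ l(2,3), of \<gamma> g] \<gamma> h1
      by (simp add: u_def x_def z_def R_def)
  qed (use h1 in simp)
  also have "\<dots> = Psi \<gamma> h1 G V h
      * (exp ((2 * u + z - \<gamma> * u\<^sup>2) / (2 * (1 + \<gamma> * z))) / sqrt (1 + \<gamma> * z))"
    by (simp add: P exp_add real_sqrt_mult)
  also have "\<dots> \<le> Psi \<gamma> h1 G V h * (1 + u)"
    using one_step_scalar[OF \<gamma> u z] h1 D by (intro mult_left_mono) (auto simp: P)
  also have "\<dots> = Psi \<gamma> h1 G V h + gradient (\<lambda>G. Psi \<gamma> h1 G V h) G \<bullet> g"
    by (simp add: grad distrib_left)
  finally show ?thesis .
qed

lemma Psi_antimono:
  assumes \<gamma>: "\<gamma> > 1" and h1: "h1 > 0" and h: "0 < h" "h \<le> h'"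
    and S: "sym_coercive m (Sigma_inv \<gamma> h1 V)" and D: "det (mat 1 + (1 / h1\<^sup>2) *\<^sub>R V) > 0"
  shows "Psi \<gamma> h1 G V h' \<le> Psi \<gamma> h1 G V h"
proof -
  have "rho \<gamma> / h' > 0" "rho \<gamma> / h' \<le> rho \<gamma> / h"
    using rho_pos[OF \<gamma>] h by (auto intro: divide_left_mono)
  then have "ball_conj (rho \<gamma> / h') (Sigma_inv \<gamma> h1 V) G \<le> ball_conj (rho \<gamma> / h) (Sigma_inv \<gamma> h1 V) G"
    by (rule ball_conj_mono[OF S])
  then show ?thesis
    using h1 D by (auto simp: Psi_eq intro!: divide_right_mono)
qed

section \<open>The potential along the rounds\<close>

lemma Sigma_inv_0_coercive:
  assumes "(\<gamma> :: real) > 0" "h1 > 0"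
  shows "sym_coercive (\<gamma> * h1\<^sup>2) (Sigma_inv \<gamma> h1 (0 :: real^'n^'n))"
  using assms by (simp add: sym_coercive_def Sigma_inv_def flip: scaleR_matrix_vector_assoc)

lemma Psi_0:
  assumes \<gamma>: "\<gamma> > 1" and h1: "h1 > 0" and h: "h > 0"
  shows "Psi \<gamma> h1 0 (0::real^'n^'n) h = h1"
proof -
  have "ball_conj (rho \<gamma> / h) (Sigma_inv \<gamma> h1 (0::real^'n^'n)) 0 = 0"
    using ball_conj_attained(1)[OF Sigma_inv_0_coercive[OF _ h1, of \<gamma>], of 0 0 "rho \<gamma> / h"]
      rho_pos[OF \<gamma>] \<gamma> h by simp
  then show ?thesis by (simp add: Psi_eq)
qed

lemma cumV_0: "cumV g 0 = 0" and cumV_Suc: "cumV g (Suc t) = cumV g t + outer (g (Suc t)) (g (Suc t))"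
  by (simp_all add: cumV_def outer_def)

lemma cumG_0: "cumG g 0 = 0" and cumG_Suc: "cumG g (Suc t) = cumG g t + g (Suc t)"
  by (simp_all add: cumG_def)

lemma Sigma_inv_cumV_coercive:
  assumes "(\<gamma> :: real) > 0" "h1 > 0"
  shows "sym_coercive (\<gamma> * h1\<^sup>2) (Sigma_inv \<gamma> h1 (cumV g t))"
  using assms
  by (induction t) (simp_all add: cumV_0 cumV_Suc Sigma_inv_add_outer Sigma_inv_0_coercive sym_coercive_add_outer)

lemma det_cumV_pos:
  assumes "(\<gamma> :: real) > 0" "h1 > 0"
  shows "det (mat 1 + (1 / h1\<^sup>2) *\<^sub>R cumV g t) > 0"
proof (induction t)
  case (Suc t)
  note S = Sigma_inv_cumV_coercive[OF assms, of g t]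
  show ?case
    unfolding cumV_Suc det_add_outer_Sigma_inv[OF S assms(2,1)]
    using Suc assms sym_coercive_inv_nonneg[OF S] by (intro mult_pos_pos add_pos_nonneg) auto
qed (simp add: cumV_0)

lemma sum_matrix_freegrad_le:
  assumes \<gamma>: "\<gamma> > 1" and h1: "h 1 > 0" and mono: "mono_on {1..} h"
    and bound: "\<And>t. t \<ge> 1 \<Longrightarrow> norm (g t) \<le> h t" and T: "T \<ge> 1"
  shows "(\<Sum>t=1..T. matrix_freegrad \<gamma> h g t \<bullet> g t)
    \<le> h 1 - Psi \<gamma> (h 1) (cumG g T) (cumV g T) (h T)"
proof -
  have \<gamma>0: "\<gamma> > 0" using \<gamma> by simp
  have hpos: "h t > 0" if "t \<ge> 1" for t
    using h1 mono_onD[OF mono, of 1 t] that by simp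
  note S = Sigma_inv_cumV_coercive[OF \<gamma>0 h1] and D = det_cumV_pos[OF \<gamma>0 h1]
  have descent: "matrix_freegrad \<gamma> h g (Suc t) \<bullet> g (Suc t)
      \<le> Psi \<gamma> (h 1) (cumG g t) (cumV g t) (h (Suc t))
        - Psi \<gamma> (h 1) (cumG g (Suc t)) (cumV g (Suc t)) (h (Suc t))" for t
    using Psi_step[OF \<gamma> h1 hpos[of "Suc t"] S[of g t] D[of g t] bound[of "Suc t"], of "cumG g t"]
    by (simp add: matrix_freegrad_def cumG_Suc cumV_Suc)
  show ?thesis
    using T
  proof (induction T rule: dec_induct)
    case base
    have "Psi \<gamma> (h 1) (cumG g 0) (cumV g 0) (h 1) = h 1"
      unfolding cumG_0 cumV_0 by (rule Psi_0[OF \<gamma> h1 h1])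
    then show ?case using descent[of 0] by simp
  next
    case (step t)
    \<comment> \<open>Round \<open>t\<close> leaves the potential at hint \<open>h t\<close>, while
      round \<open>Suc t\<close> starts from hint \<open>h (Suc t)\<close>; the change of hint only
      lowers it.\<close>
    have "h t \<le> h (Suc t)" using step mono_onD[OF mono, of t "Suc t"] by simp
    then have "Psi \<gamma> (h 1) (cumG g t) (cumV g t) (h (Suc t)) \<le> Psi \<gamma> (h 1) (cumG g t) (cumV g t) (h t)"
      using step by (intro Psi_antimono[OF \<gamma> h1 hpos _ S D]) auto
    then show ?case using step.IH descent[of t] by simp
  qed
qed

section \<open>The comparator term and the regret bound\<close>

lemma det_factor_eq:
  assumes \<gamma>: "\<gamma> > 0" and h1: "h 1 > 0"
  shows "det_factor \<gamma> h g T = det (mat 1 + (1 / (h 1)\<^sup>2) *\<^sub>R cumV g T) / (h 1)\<^sup>2"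
proof -
  define M where "M = mat 1 + (1 / (h 1)\<^sup>2) *\<^sub>R cumV g T"
  define S where "S = Sigma_inv \<gamma> (h 1) (cumV g T)"
  have S: "sym_coercive (\<gamma> * (h 1)\<^sup>2) S"
    unfolding S_def by (rule Sigma_inv_cumV_coercive[OF \<gamma> h1])
  have SM: "S = (\<gamma> * (h 1)\<^sup>2) *\<^sub>R M"
    using h1 \<gamma> by (simp add: S_def Sigma_inv_def M_def scaleR_right_distrib)
  have "((\<gamma> * (h 1)\<^sup>2) *\<^sub>R matrix_inv S) ** M = mat 1"
  proof (subst matrix_eq, intro allI)
    fix x
    have "(((\<gamma> * (h 1)\<^sup>2) *\<^sub>R matrix_inv S) ** M) *v x = matrix_inv S *v (S *v x)"
      by (simp add: SM matrix_vector_mult_scaleR flip: matrix_vector_mul_assoc scaleR_matrix_vector_assoc)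
    then show "(((\<gamma> * (h 1)\<^sup>2) *\<^sub>R matrix_inv S) ** M) *v x = mat 1 *v x"
      by (simp add: matrix_inv_mult_vec[OF S])
  qed
  then have "det ((\<gamma> * (h 1)\<^sup>2) *\<^sub>R matrix_inv S) * det M = 1"
    by (metis det_I det_mul)
  then have "inverse (det ((\<gamma> * (h 1)\<^sup>2) *\<^sub>R matrix_inv S)) = det M"
    by (rule inverse_unique)
  then show ?thesis
    by (simp only: det_factor_def Sigma_mat_def S_def M_def)
qed

text \<open>Evaluating the dual form at \<open>- s *\<^sub>R w\<close> leaves a problem in the
  single number \<open>X\<close>, solved by \<open>linear_minus_exp_le\<close>. The scale
  \<open>s = 1 / sqrt y\<close> comes from \<open>conjugate_scalar\<close>, whose constraint
  \<open>x \<le> y\<close> says that this point lies in the ball.\<close>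

lemma neg_inner_minus_Psi_le:
  assumes \<gamma>: "\<gamma> > 1" and h1: "h 1 > 0" and h: "h T > 0"
  shows "- (w \<bullet> G) - Psi \<gamma> (h 1) G (cumV g T) (h T)
    \<le> sqrt (Q \<gamma> h g T w * ln_plus (det_factor \<gamma> h g T * Q \<gamma> h g T w))"
proof -
  have \<gamma>0: "\<gamma> > 0" using \<gamma> by simp
  define S where "S = Sigma_inv \<gamma> (h 1) (cumV g T)"
  define D where "D = det (mat 1 + (1 / (h 1)\<^sup>2) *\<^sub>R cumV g T)"
  define F where "F = det_factor \<gamma> h g T"
  define q where "q = w \<bullet> (S *v w)"
  define x where "x = (h T)\<^sup>2 * (norm w)\<^sup>2 / (rho \<gamma>)\<^sup>2"
  define X where "X = - (w \<bullet> G)"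
  have S: "sym_coercive (\<gamma> * (h 1)\<^sup>2) S"
    unfolding S_def by (rule Sigma_inv_cumV_coercive[OF \<gamma>0 h1])
  have D: "D > 0" unfolding D_def by (rule det_cumV_pos[OF \<gamma>0 h1])
  have FD: "F = D / (h 1)\<^sup>2" by (simp add: F_def D_def det_factor_eq[of \<gamma> h, OF \<gamma>0 h1])
  have F: "F > 0" using D h1 by (simp add: FD)
  have "q \<ge> 0" unfolding q_def by (rule sym_coercive_nonneg[OF S])
  moreover have "x \<ge> 0" by (simp add: x_def)
  ultimately obtain y where y: "y > 0" "x \<le> y"
    "q / (2 * sqrt y) + sqrt y / 2 * ln (F * y) - sqrt y
      \<le> sqrt (Q \<gamma> h g T w * ln_plus (F * Q \<gamma> h g T w))"
    using conjugate_scalar[OF F] unfolding Q_def Let_def S_def[symmetric]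
      F_def[symmetric] q_def[symmetric] x_def[symmetric]
    by metis
  define s where "s = 1 / sqrt y"
  have s: "s > 0" using y by (simp add: s_def)
  have "norm (- s *\<^sub>R w) \<le> rho \<gamma> / h T"
  proof -
    have "(h T * norm w / rho \<gamma>)\<^sup>2 \<le> y" using y by (simp add: x_def power_divide power_mult_distrib)
    then have "h T * norm w / rho \<gamma> \<le> sqrt y" by (rule real_le_rsqrt)
    then show ?thesis using y h rho_pos[OF \<gamma>] by (simp add: s_def field_simps)
  qed
  from ball_conj_ge[OF S this, of G]
  have "s * X - s\<^sup>2 * q / 2 \<le> ball_conj (rho \<gamma> / h T) S G"
    unfolding matrix_vector_mult_scaleR inner_scaleR_left inner_scaleR_right
    by (simp add: X_def q_def power2_eq_square)
  then have "exp (s * X - s\<^sup>2 * q / 2) / sqrt F \<le> exp (ball_conj (rho \<gamma> / h T) S G) / sqrt F"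
    using F by (intro divide_right_mono) auto
  \<comment> \<open>The prefactor \<open>h 1 / sqrt D\<close> of the potential is
    \<open>1 / sqrt F\<close>.\<close>
  also have "\<dots> = Psi \<gamma> (h 1) G (cumV g T) (h T)"
    using h1 by (simp add: Psi_eq FD S_def D_def real_sqrt_divide)
  finally have "X - Psi \<gamma> (h 1) G (cumV g T) (h T) \<le> X - exp (s * X - s\<^sup>2 * q / 2) / sqrt F" by simp
  also have "\<dots> \<le> (s\<^sup>2 * q / 2 - 1 + ln (F / s\<^sup>2) / 2) / s" by (rule linear_minus_exp_le[OF s F])
  also have "\<dots> = q / (2 * sqrt y) + sqrt y / 2 * ln (F * y) - sqrt y"
  proof -
    have "s\<^sup>2 = 1 / y" using y by (simp add: s_def power_divide)
    moreover have "q * sqrt y / (y * 2) = q / (sqrt y * 2)" using y by (simp add: field_simps)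
    ultimately show ?thesis using y by (simp add: s_def algebra_simps)
  qed
  finally show ?thesis using y(3) by (simp add: X_def F_def)
qed

theorem theorem10:
  fixes \<gamma> :: real
    and g :: "nat \<Rightarrow> real^'n"
    and hint :: "(nat \<Rightarrow> real^'n) \<Rightarrow> nat \<Rightarrow> real"
    and T :: nat
    and w :: "real^'n"
  assumes "\<gamma> > 1"
    and "norm (g 1) > 0"
    and "mono_on {1..} (hint g)"
    and "\<And>t. t \<ge> 1 \<Longrightarrow> hint g t \<ge> (MAX s\<in>{1..t}. norm (g s))"
    and "\<And>c t. c > 0 \<Longrightarrow> t \<ge> 1 \<Longrightarrow> hint (\<lambda>s. c *\<^sub>R g s) t = c * hint g t"
    and "T \<ge> 1"
  shows "(\<Sum>t=1..T. (matrix_freegrad \<gamma> (hint g) g t - w) \<bullet> g t)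
    \<le> hint g 1 + sqrt (Q \<gamma> (hint g) g T w
         * ln_plus (det_factor \<gamma> (hint g) g T * Q \<gamma> (hint g) g T w))"
proof -
  have bound: "norm (g t) \<le> hint g t" if "t \<ge> 1" for t
  proof -
    have "norm (g t) \<le> (MAX s\<in>{1..t}. norm (g s))" using that by (intro Max_ge) auto
    then show ?thesis using assms(4)[OF that] by linarith
  qed
  have h1: "hint g 1 > 0" using bound[of 1] assms(2) by linarith
  have hT: "hint g T > 0" using h1 mono_onD[OF assms(3), of 1 T] assms(6) by simp
  have "(\<Sum>t=1..T. (matrix_freegrad \<gamma> (hint g) g t - w) \<bullet> g t)
      = (\<Sum>t=1..T. matrix_freegrad \<gamma> (hint g) g t \<bullet> g t) - w \<bullet> cumG g T"
    by (simp add: inner_diff_left sum_subtractf cumG_def inner_sum_right)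
  \<comment> \<open>The final potential, subtracted in the bound on the learner's loss, is what
    keeps the comparator term bounded.\<close>
  then show ?thesis
    using sum_matrix_freegrad_le[OF assms(1) h1 assms(3) bound assms(6)]
      neg_inner_minus_Psi_le[where h = "hint g", OF assms(1) h1 hT, of w "cumG g T" g]
    by simp
qed

end
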